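(* The following inequalities hold: (1) $\mathrm{add}(\mathcal{M})\leq\mathrm{add}^*_t(\mathcal{E})\leq\mathfrak{b}$; (2) $\mathfrak{d}\leq\mathrm{cof}^*_t(\mathcal{E})\leq\mathrm{cof}(\mathcal{M})$.
   Context: $2^\omega$ is the Cantor space with coordinatewise addition modulo 2; $\mathcal{M}$ is the $\sigma$-ideal of meager subsets of $2^\omega$ and $\mathcal{E}$ is the $\sigma$-ideal on $2^\omega$ generated by closed Lebesgue measure zero sets. For a $\sigma$-ideal $\mathcal{I}$ on $2^\omega$: $\mathrm{add}(\mathcal{I})=\min\{|\mathcal{F}|:\mathcal{F}\subseteq\mathcal{I},\ \bigcup\mathcal{F}\notin\mathcal{I}\}$; $\mathrm{cof}(\mathcal{I})=\min\{|\mathcal{F}|:\mathcal{F}\subseteq\mathcal{I},\ \forall Y\in\mathcal{I}\ \exists Y'\in\mathcal{F}\ Y\subseteq Y'\}$; $\mathrm{add}^*_t(\mathcal{I})=\min\{|\mathcal{F}|:\mathcal{F}\subseteq\mathcal{I}\text{ and }\neg\exists X\in\mathcal{I}\ \forall F\in\mathcal{F}\ \exists x\in2^\omega\ F+x\subseteq X\}$; $\mathrm{cof}^*_t(\mathcal{I})=\min\{|\mathcal{F}|:\mathcal{F}\subseteq\mathcal{I}\text{ and }\forall Y\in\mathcal{I}\ \exists Y'\in\mathcal{F}\ \exists x\in2^\omega\ Y\subseteq Y'+x\}$. $\mathfrak{b}$ and $\mathfrak{d}$ are the bounding and dominating numbers of $(\omega^\omega,\leq^* )$. *)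

theory Defs
  imports "HOL-Probability.Probability"
begin

unbundle cardinal_syntax

section \<open>Cardinal invariants as cardinals\<close>

text \<open>
  Cardinals are represented, as in the library, by cardinal orders, compared by \<open>\<le>o\<close> across
  types and identified up to \<open>=o\<close>. \<open>min_card P\<close> is \<open>min {|F|. P F}\<close>; it is meaningful whenever
  some \<open>F\<close> satisfies \<open>P\<close>, see \<open>min_card_attained\<close> and \<open>min_card_le\<close>.
\<close>

definition min_card :: "('a set \<Rightarrow> bool) \<Rightarrow> 'a rel" where
  "min_card P = (SOME r. r \<in> card_of ` {F. P F} \<and> (\<forall>F. P F \<longrightarrow> r \<le>o |F| ))"

lemma min_card_spec:
  assumes "P F0"
  shows "min_card P \<in> card_of ` {F. P F} \<and> (\<forall>F. P F \<longrightarrow> min_card P \<le>o |F| )"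
proof -
  have "\<exists>r\<in>card_of ` {F. P F}. \<forall>r'\<in>card_of ` {F. P F}. r \<le>o r'"
    by (rule exists_minim_Card_order) (use assms in \<open>auto simp: card_of_Card_order\<close>)
  then have "\<exists>r. r \<in> card_of ` {F. P F} \<and> (\<forall>F. P F \<longrightarrow> r \<le>o |F| )"
    by blast
  then show ?thesis
    unfolding min_card_def by (rule someI_ex)
qed

lemma min_card_attained:
  assumes "P F0"
  obtains F where "P F" "min_card P = |F|"
  using min_card_spec[of P, OF assms] by auto

lemma min_card_le:
  assumes "P F"
  shows "min_card P \<le>o |F|"
  using min_card_spec[of P, OF assms] assms by blast

definition ideal_add :: "'a set set \<Rightarrow> 'a set rel" where
  "ideal_add I = min_card (\<lambda>F. F \<subseteq> I \<and> \<Union>F \<notin> I)"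

definition ideal_cof :: "'a set set \<Rightarrow> 'a set rel" where
  "ideal_cof I = min_card (\<lambda>F. F \<subseteq> I \<and> (\<forall>Y\<in>I. \<exists>Y'\<in>F. Y \<subseteq> Y'))"

definition le_star :: "(nat \<Rightarrow> nat) \<Rightarrow> (nat \<Rightarrow> nat) \<Rightarrow> bool" (infix \<open>\<le>\<^sup>*\<close> 50) where
  "f \<le>\<^sup>* g \<longleftrightarrow> (\<forall>\<^sub>F n in sequentially. f n \<le> g n)"

definition bounding_number :: "(nat \<Rightarrow> nat) rel" where
  "bounding_number = min_card (\<lambda>F. \<not> (\<exists>g. \<forall>f\<in>F. f \<le>\<^sup>* g))"

definition dominating_number :: "(nat \<Rightarrow> nat) rel" where
  "dominating_number = min_card (\<lambda>F. \<forall>g. \<exists>f\<in>F. g \<le>\<^sup>* f)"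


section \<open>The Cantor space\<close>

text \<open>
  The topology on \<open>nat \<Rightarrow> bool\<close> is the library's product topology with \<open>bool\<close> discrete.
  Addition modulo 2 on \<open>bool\<close> is exclusive or, i.e. \<open>\<noteq>\<close>.
\<close>

type_synonym cantor = "nat \<Rightarrow> bool"

definition cantor_add :: "cantor \<Rightarrow> cantor \<Rightarrow> cantor" (infixl \<open>+\<^sub>2\<close> 65) where
  "x +\<^sub>2 y = (\<lambda>n. x n \<noteq> y n)"

definition translate :: "cantor set \<Rightarrow> cantor \<Rightarrow> cantor set" where
  "translate A x = (\<lambda>a. a +\<^sub>2 x) ` A"

definition ideal_add_star_t :: "cantor set set \<Rightarrow> cantor set rel" where
  "ideal_add_star_t I =
     min_card (\<lambda>F. F \<subseteq> I \<and> \<not> (\<exists>X\<in>I. \<forall>A\<in>F. \<exists>x. translate A x \<subseteq> X))"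

definition ideal_cof_star_t :: "cantor set set \<Rightarrow> cantor set rel" where
  "ideal_cof_star_t I =
     min_card (\<lambda>F. F \<subseteq> I \<and> (\<forall>Y\<in>I. \<exists>Y'\<in>F. \<exists>x. Y \<subseteq> translate Y' x))"


section \<open>The ideals\<close>

definition nowhere_dense :: "'a::topological_space set \<Rightarrow> bool" where
  "nowhere_dense A \<longleftrightarrow> interior (closure A) = {}"

definition meager :: "'a::topological_space set \<Rightarrow> bool" where
  "meager A \<longleftrightarrow> (\<exists>N. countable N \<and> (\<forall>B\<in>N. nowhere_dense B) \<and> A = \<Union>N)"

definition meager_ideal :: "cantor set set" where
  "meager_ideal = {A. meager A}"

definition sigma_ideal :: "'a set set \<Rightarrow> bool" where
  "sigma_ideal I \<longleftrightarrow>
     {} \<in> I \<and> (\<forall>A\<in>I. \<forall>B. B \<subseteq> A \<longrightarrow> B \<in> I) \<and> (\<forall>F. F \<subseteq> I \<and> countable F \<longrightarrow> \<Union>F \<in> I)"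

definition sigma_ideal_generated :: "'a set set \<Rightarrow> 'a set set" where
  "sigma_ideal_generated G = \<Inter>{I. sigma_ideal I \<and> G \<subseteq> I}"

text \<open>Lebesgue measure on the Cantor space is the product of the fair coin measures; its
  \<open>\<sigma>\<close>-algebra is the Borel one, so every closed set is measurable.\<close>

definition cantor_measure :: "cantor measure" where
  "cantor_measure = PiM UNIV (\<lambda>_. uniform_count_measure (UNIV :: bool set))"

instance bool :: second_countable_topology
proof
  have "open = generate_topology (range lessThan \<union> range (greaterThan :: bool \<Rightarrow> _))"
    by (rule open_bool_def)
  moreover have "countable (range lessThan \<union> range (greaterThan :: bool \<Rightarrow> _))"
    by (rule countable_finite) simp
  ultimately show "\<exists>B::bool set set. countable B \<and> open = generate_topology B"
    by blast
qed

lemma sets_uniform_count_measure_bool: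
  "sets (uniform_count_measure (UNIV :: bool set)) = sets borel"
proof -
  have "A \<in> sets borel" for A :: "bool set"
    by (rule borel_open) (rule Topological_Spaces.open_discrete)
  then show ?thesis
    by (auto simp: sets_uniform_count_measure)
qed

lemma sets_cantor_measure: "sets cantor_measure = sets borel"
proof -
  have "sets cantor_measure = sets (PiM UNIV (\<lambda>_::nat. borel :: bool measure))"
    unfolding cantor_measure_def
    by (rule sets_PiM_cong) (simp_all add: sets_uniform_count_measure_bool)
  then show ?thesis
    by (simp add: sets_PiM_equal_borel)
qed

definition closed_null_ideal :: "cantor set set" where
  "closed_null_ideal = sigma_ideal_generated {C. closed C \<and> C \<in> null_sets cantor_measure}"

end

theory Submission
  imports Defs
begin

text \<open>
  Both pairs of inequalities follow from two Galois--Tukey connections.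

  Meager side: write \<open>A \<in> \<E>\<close> as a subset of an increasing union of closed null sets \<open>C n\<close>. A point
  \<open>y\<close> encodes, by runs of \<open>True\<close>, a clopen set of measure at most \<open>2\<^sup>-\<^sup>n\<close> for some of the \<open>n\<close>, and
  the \<open>y\<close> whose \<open>n\<close>-th set covers \<open>C n\<close> for only finitely many \<open>n\<close> form a meager set. If a meager
  \<open>B\<close> contains it, take a point \<open>x\<close> and an interval partition such that every \<open>y\<close> matching \<open>x\<close> on
  infinitely many blocks lies outside \<open>B\<close>. Then almost every block contains an \<open>n\<close> at which \<open>x\<close> itself
  covers \<open>C n\<close>: otherwise keep \<open>x\<close> on the bad blocks and put \<open>False\<close> elsewhere. Hence \<open>A\<close> lies in the
  set of \<open>z\<close> that, for almost all blocks, belong to one of the sets that \<open>x\<close> encodes there, and this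
  set is in \<open>\<E>\<close> and depends on \<open>B\<close> only.

  Bounding side: send \<open>f\<close> to the closed null set of points vanishing on the range of an increasing
  function above \<open>f\<close>. If a translate of it is covered by closed null sets \<open>C n\<close>, then by Baire some
  \<open>C n\<close> contains a relatively open part, and the rate at which the measures of the clopen
  approximations of \<open>C n\<close> tend to \<open>0\<close> bounds \<open>f\<close>.
\<close>

section \<open>Clopen sets and measure on the Cantor space\<close>

text \<open>Finite \<open>S\<close> gives the basic clopen sets, infinite \<open>S\<close> the
  closed null sets used for the bounding number.\<close>

definition cylinder :: "nat set \<Rightarrow> cantor \<Rightarrow> cantor set" where
  "cylinder S u = {z. \<forall>i\<in>S. z i = u i}"

lemma mem_cylinder_iff: "z \<in> cylinder S u \<longleftrightarrow> (\<forall>i\<in>S. z i = u i)"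
  by (simp add: cylinder_def)

lemma closed_cylinder: "closed (cylinder S u)"
proof -
  have "cylinder S u = (\<Inter>i\<in>S. (\<lambda>z. z i) -` {u i})"
    by (auto simp: cylinder_def)
  moreover have "closed ((\<lambda>z. z i) -` {u i})" for i
    by (rule closed_vimage) auto
  ultimately show ?thesis
    by (simp add: closed_INT)
qed

lemma open_cylinder:
  assumes "finite S"
  shows "open (cylinder S u)"
proof -
  have "cylinder S u = (\<Inter>i\<in>S. (\<lambda>z. z i) -` {u i})"
    by (auto simp: cylinder_def)
  moreover have "open ((\<lambda>z. z i) -` {u i})" for i
    by (rule open_vimage) (auto intro: Topological_Spaces.open_discrete)
  ultimately show ?thesis
    using assms by (simp add: open_INT)
qed

lemma open_contains_cylinder:
  fixes U :: "cantor set"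
  assumes "open U" "u \<in> U"
  obtains m where "cylinder {..<m} u \<subseteq> U"
proof -
  obtain X where X: "u \<in> (\<Pi>\<^sub>E i\<in>UNIV. X i)" "finite {i. X i \<noteq> UNIV}" "(\<Pi>\<^sub>E i\<in>UNIV. X i) \<subseteq> U"
    using product_topology_open_contains_basis[of "\<lambda>_. euclidean" UNIV U u] assms
    by (auto simp: open_fun_def)
  obtain m where m: "\<And>i. X i \<noteq> UNIV \<Longrightarrow> i < m"
    using X(2) unfolding finite_nat_set_iff_bounded by blast
  have "cylinder {..<m} u \<subseteq> (\<Pi>\<^sub>E i\<in>UNIV. X i)"
  proof
    fix z assume z: "z \<in> cylinder {..<m} u"
    have "z i \<in> X i" for i
      using z m[of i] X(1) by (cases "i < m") (auto simp: mem_cylinder_iff PiE_iff)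
    then show "z \<in> (\<Pi>\<^sub>E i\<in>UNIV. X i)"
      by auto
  qed
  then show thesis
    by (intro that[of m] order_trans[OF _ X(3)])
qed

section \<open>The coin-tossing measure\<close>

lemma product_prob_space_coin: "product_prob_space (\<lambda>_. uniform_count_measure (UNIV :: bool set))"
  by (intro product_prob_spaceI prob_space_uniform_count_measure) auto

interpretation cantor: prob_space cantor_measure
  unfolding cantor_measure_def
  by (intro prob_space_PiM prob_space_uniform_count_measure) auto

lemma closed_in_sets_cantor: "closed A \<Longrightarrow> A \<in> sets cantor_measure"
  by (simp add: sets_cantor_measure)

lemma measure_cylinder:
  assumes "finite S"
  shows "measure cantor_measure (cylinder S u) = (1/2) ^ card S"
proof -
  interpret coin: product_prob_space "\<lambda>_::nat. uniform_count_measure (UNIV :: bool set)" UNIV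
    by (rule product_prob_space_coin)
  have "z i \<in> (if i \<in> S then {u i} else UNIV) \<longleftrightarrow> (i \<in> S \<longrightarrow> z i = u i)" for z i
    by simp
  then have "cylinder S u = prod_emb UNIV (\<lambda>_. uniform_count_measure UNIV) S (\<Pi>\<^sub>E i\<in>S. {u i})"
    by (simp only: prod_emb_PiE space_uniform_count_measure set_eq_iff mem_cylinder_iff PiE_UNIV_domain
        Pi_iff subset_UNIV Ball_def UNIV_I simp_thms)
  then show ?thesis
    using assms coin.measure_PiM_emb[of S "\<lambda>i. {u i}"]
    by (simp add: cantor_measure_def measure_uniform_count_measure sets_uniform_count_measure)
qed

lemma closed_null_iff:
  "closed C \<and> C \<in> null_sets cantor_measure \<longleftrightarrow> closed C \<and> measure cantor_measure C = 0"
  using closed_in_sets_cantor[of C]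
  by (auto simp: null_sets_def cantor.emeasure_eq_measure)

section \<open>Outer clopen approximations and codes for clopen sets\<close>

definition approx :: "cantor set \<Rightarrow> nat \<Rightarrow> cantor set" where
  "approx A m = (\<Union>a\<in>A. cylinder {..<m} a)"

lemma subset_approx: "A \<subseteq> approx A m"
  by (auto simp: approx_def mem_cylinder_iff)

text \<open>Natural numbers name finite lists of binary strings, so the length of a run of
  \<open>True\<close> can encode a clopen set.\<close>

definition clopen_code :: "nat \<Rightarrow> cantor set" where
  "clopen_code j = (\<Union>s\<in>set (from_nat j :: bool list list). cylinder {..<length s} (\<lambda>i. s ! i))"

lemma closed_clopen_code: "closed (clopen_code j)"
  unfolding clopen_code_def by (intro closed_UN ballI closed_cylinder finite_set)

text \<open>There are only finitely many binary strings of length \<open>m\<close>.\<close>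

lemma approx_eq_clopen_code:
  obtains j where "approx A m = clopen_code j"
proof -
  have "(\<lambda>a. map a [0..<m]) ` A \<subseteq> {s. set s \<subseteq> UNIV \<and> length s = m}"
    by auto
  then have "finite ((\<lambda>a. map a [0..<m]) ` A)"
    by (rule finite_subset) (rule finite_lists_length_eq, simp)
  then obtain l where l: "set l = (\<lambda>a. map a [0..<m]) ` A"
    using finite_list by blast
  have "approx A m = clopen_code (to_nat l)"
    by (auto simp: approx_def clopen_code_def l mem_cylinder_iff)
  then show thesis
    by (rule that)
qed

text \<open>A closed set is the decreasing intersection of its approximations, so the measure is
  continuous from above along them.\<close>

lemma approx_measure_tendsto:
  assumes "closed A"
  shows "(\<lambda>m. measure cantor_measure (approx A m)) \<longlonglongrightarrow> measure cantor_measure A"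
proof -
  have closed_approx: "closed (approx A m)" for m
    by (metis approx_eq_clopen_code closed_clopen_code)
  have "(\<Inter>m. approx A m) = A"
  proof
    show "(\<Inter>m. approx A m) \<subseteq> A"
    proof (rule ccontr)
      assume "\<not> (\<Inter>m. approx A m) \<subseteq> A"
      then obtain z where z: "\<And>m. z \<in> approx A m" "z \<in> - A"
        by auto
      obtain m where "cylinder {..<m} z \<subseteq> - A"
        using open_contains_cylinder[of "- A" z] z(2) assms by blast
      moreover obtain a where "a \<in> A" "z \<in> cylinder {..<m} a"
        using z(1)[of m] by (auto simp: approx_def)
      moreover from this have "a \<in> cylinder {..<m} z"
        by (simp add: mem_cylinder_iff)
      ultimately show False
        by blast
    qed
  qed (use subset_approx in blast)
  moreover have "cylinder {..<n} a \<subseteq> cylinder {..<m} a" if "m \<le> n" for m n a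
    using that by (simp add: cylinder_def subset_iff)
  then have "decseq (approx A)"
    unfolding decseq_def approx_def by blast
  ultimately show ?thesis
    using cantor.finite_Lim_measure_decseq[of "approx A"] closed_approx closed_in_sets_cantor by auto
qed

lemma measure_approx_lt:
  assumes "closed A" "measure cantor_measure A = 0" "e > 0"
  obtains m where "measure cantor_measure (approx A m) < e"
proof -
  have "\<forall>\<^sub>F m in sequentially. measure cantor_measure (approx A m) < e"
    using approx_measure_tendsto[OF assms(1)] assms(2,3) order_tendstoD(2) by metis
  then show thesis
    using that eventually_happens'[OF sequentially_bot] by blast
qed

lemma small_clopen_cover:
  assumes "closed A" "measure cantor_measure A = 0" "e > 0"
  obtains j where "A \<subseteq> clopen_code j" "measure cantor_measure (clopen_code j) < e"
proof -
  obtain m where m: "measure cantor_measure (approx A m) < e"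
    using measure_approx_lt[OF assms] by blast
  obtain j where "approx A m = clopen_code j"
    by (rule approx_eq_clopen_code)
  with m subset_approx[of A m] show thesis
    by (intro that[of j]) simp_all
qed

text \<open>The sets satisfying the right-hand side form a sigma-ideal containing the generators,
  and every such sigma-ideal contains them.\<close>

lemma closed_null_ideal_iff:
  "A \<in> closed_null_ideal \<longleftrightarrow>
     (\<exists>C. (\<forall>n. closed (C n) \<and> measure cantor_measure (C n) = 0) \<and> A \<subseteq> (\<Union>n::nat. C n))"
    (is "_ \<longleftrightarrow> ?E A")
proof
  have "sigma_ideal {A. ?E A}"
    unfolding sigma_ideal_def
  proof (intro conjI allI ballI impI)
    show "{} \<in> {A. ?E A}"
      by (auto intro!: exI[of _ "\<lambda>_. {}"])
  next
    fix A B assume "A \<in> {A. ?E A}" "B \<subseteq> A"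
    then show "B \<in> {A. ?E A}"
      by blast
  next
    fix F assume F: "F \<subseteq> {A. ?E A} \<and> countable F"
    then have "\<forall>A\<in>F. ?E A"
      by blast
    then obtain C where C: "\<And>A n. A \<in> F \<Longrightarrow> closed (C A n)"
        "\<And>A n. A \<in> F \<Longrightarrow> measure cantor_measure (C A n) = 0" "\<And>A. A \<in> F \<Longrightarrow> A \<subseteq> (\<Union>n::nat. C A n)"
      by metis
    \<comment> \<open>The empty set is closed and null; adding it keeps the enumeration meaningful
      when \<open>F\<close> is empty.\<close>
    define G where "G = insert {} (\<Union>A\<in>F. range (C A))"
    have G: "countable G" "G \<noteq> {}"
      using F by (auto simp: G_def)
    have "closed (from_nat_into G n) \<and> measure cantor_measure (from_nat_into G n) = 0" for n
      using from_nat_into[OF G(2), of n] C by (auto simp: G_def)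
    moreover have "\<Union>F \<subseteq> (\<Union>n. from_nat_into G n)"
      using range_from_nat_into[OF G(2,1)] C(3) by (fastforce simp: G_def)
    ultimately show "\<Union>F \<in> {A. ?E A}"
      by blast
  qed
  moreover have "{C. closed C \<and> C \<in> null_sets cantor_measure} \<subseteq> {A. ?E A}"
  proof
    fix D assume "D \<in> {C. closed C \<and> C \<in> null_sets cantor_measure}"
    then have "closed D \<and> measure cantor_measure D = 0"
      using closed_null_iff by simp
    then have "?E D"
      by (intro exI[of _ "\<lambda>_. D"]) simp
    then show "D \<in> {A. ?E A}"
      by simp
  qed
  ultimately show "A \<in> closed_null_ideal \<Longrightarrow> ?E A"
    by (auto simp: closed_null_ideal_def sigma_ideal_generated_def)
next
  assume "?E A"
  then obtain C where C: "\<And>n. closed (C n) \<and> C n \<in> null_sets cantor_measure" "A \<subseteq> (\<Union>n::nat. C n)"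
    using closed_null_iff by metis
  show "A \<in> closed_null_ideal"
    unfolding closed_null_ideal_def sigma_ideal_generated_def
  proof (intro InterI)
    fix I assume "I \<in> {I. sigma_ideal I \<and> {C. closed C \<and> C \<in> null_sets cantor_measure} \<subseteq> I}"
    then have I: "sigma_ideal I" "range C \<subseteq> I"
      using C(1) by auto
    then have "(\<Union>n. C n) \<in> I"
      by (simp add: sigma_ideal_def)
    then show "A \<in> I"
      using I(1) C(2) by (auto simp: sigma_ideal_def)
  qed
qed

section \<open>Chopped reals\<close>

lemma nowhere_dense_avoid:
  fixes N :: "cantor set"
  assumes "nowhere_dense N"
  obtains v m where "v \<in> cylinder {..<q} u" "q \<le> m" "cylinder {..<m} v \<inter> N = {}"
proof -
  have "\<not> cylinder {..<q} u \<subseteq> closure N"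
  proof
    assume "cylinder {..<q} u \<subseteq> closure N"
    then have "cylinder {..<q} u \<subseteq> interior (closure N)"
      by (intro interior_maximal open_cylinder) auto
    moreover have "u \<in> cylinder {..<q} u"
      by (simp add: mem_cylinder_iff)
    ultimately show False
      using assms by (auto simp: nowhere_dense_def)
  qed
  then obtain v where v: "v \<in> cylinder {..<q} u" "v \<in> - closure N"
    by auto
  obtain m where m: "cylinder {..<m} v \<subseteq> - closure N"
    using open_contains_cylinder[of "- closure N" v] v(2) by auto
  have "cylinder {..<max m q} v \<subseteq> cylinder {..<m} v"
    by (simp add: cylinder_def subset_iff)
  then have "cylinder {..<max m q} v \<inter> N = {}"
    using m closure_subset[of N] by blast
  with v(1) show thesis
    by (intro that[of v "max m q"]) simp_all
qed

text \<open>Induction on \<open>R\<close> only ever lengthens the block, so pairs already treated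
  stay avoided. The new pair is handled by extending \<open>t\<close> below \<open>p\<close>
  followed by the block built so far.\<close>

lemma nowhere_dense_block_pairs:
  fixes R :: "(cantor \<times> cantor set) set"
  assumes "finite R" "\<And>t N. (t, N) \<in> R \<Longrightarrow> nowhere_dense N"
  shows "\<exists>q\<ge>p. \<exists>s. \<forall>(t, N)\<in>R. \<forall>y. (\<forall>i<p. y i = t i) \<and> (\<forall>i\<in>{p..<q}. y i = s i) \<longrightarrow> y \<notin> N"
  using assms
proof (induction R rule: finite_induct)
  case empty
  then show ?case by auto
next
  case (insert r R)
  obtain t N where r: "r = (t, N)"
    by (cases r)
  have "\<exists>q\<ge>p. \<exists>s. \<forall>(t, N)\<in>R. \<forall>y. (\<forall>i<p. y i = t i) \<and> (\<forall>i\<in>{p..<q}. y i = s i) \<longrightarrow> y \<notin> N"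
  proof (rule insert.IH)
    show "nowhere_dense N'" if "(t', N') \<in> R" for t' N'
      using insert.prems[of t' N'] that by simp
  qed
  then obtain q s where q: "q \<ge> p" and
    R: "\<forall>(t, N)\<in>R. \<forall>y. (\<forall>i<p. y i = t i) \<and> (\<forall>i\<in>{p..<q}. y i = s i) \<longrightarrow> y \<notin> N"
    by (elim exE conjE)
  have s: "y \<notin> N" if "(t, N) \<in> R" "\<forall>i<p. y i = t i" "\<forall>i\<in>{p..<q}. y i = s i" for t N y
    using bspec[OF R that(1)] that(2,3) by simp
  have "nowhere_dense N"
    using insert.prems[of t N] r by simp
  then obtain v m where v: "v \<in> cylinder {..<q} (\<lambda>i. if i < p then t i else s i)"
    and m: "q \<le> m" "cylinder {..<m} v \<inter> N = {}"
    by (rule nowhere_dense_avoid)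
  have "y \<notin> N'" if y: "(t', N') \<in> insert r R" "\<forall>i<p. y i = t' i" "\<forall>i\<in>{p..<m}. y i = v i" for t' N' y
  proof (cases "(t', N') \<in> R")
    case True
    moreover have "\<forall>i\<in>{p..<q}. y i = s i"
      using y(3) v m(1) by (simp add: mem_cylinder_iff)
    ultimately show ?thesis
      using s y(2) by blast
  next
    case False
    then have eq: "t' = t" "N' = N"
      using y(1) r by auto
    have "y i = v i" if "i < m" for i
      using y(2,3) v q m(1) that unfolding eq mem_cylinder_iff by (cases "i < p") simp_all
    then have "y \<in> cylinder {..<m} v"
      by (simp add: mem_cylinder_iff)
    with m(2) show ?thesis
      unfolding eq by blast
  qed
  moreover have "m \<ge> p"
    using q m(1) by simp
  ultimately show ?case
    by blast
qed

text \<open>The value \<open>False\<close> at the end of the block keeps runs of \<open>True\<close> inside it.\<close>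

lemma nowhere_dense_block:
  fixes NN :: "cantor set set"
  assumes "finite NN" "\<And>N. N \<in> NN \<Longrightarrow> nowhere_dense N"
  obtains q s where "q > p" "\<not> s (q - 1)"
    "\<And>y N. \<lbrakk>N \<in> NN; \<forall>i\<in>{p..<q}. y i = s i\<rbrakk> \<Longrightarrow> y \<notin> N"
proof -
  \<comment> \<open>One representative for each of the finitely many patterns below
    \<open>p\<close>; treating all of them makes the block work whatever precedes it.\<close>
  define T where "T = (\<lambda>D i. i \<in> D) ` Pow {..<p}"
  have T: "\<exists>t\<in>T. \<forall>i<p. y i = t i" for y
    by (rule bexI[of _ "\<lambda>i. i \<in> {i. i < p \<and> y i}"])
       (simp, unfold T_def, rule imageI, simp add: subset_iff)
  have "finite (T \<times> NN)"
    using assms(1) by (simp add: T_def)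
  then have "\<exists>q\<ge>p. \<exists>s. \<forall>(t, N)\<in>T \<times> NN. \<forall>y.
      (\<forall>i<p. y i = t i) \<and> (\<forall>i\<in>{p..<q}. y i = s i) \<longrightarrow> y \<notin> N"
    by (rule nowhere_dense_block_pairs) (simp add: assms(2))
  then obtain q s where q: "q \<ge> p" and R: "\<forall>(t, N)\<in>T \<times> NN. \<forall>y.
      (\<forall>i<p. y i = t i) \<and> (\<forall>i\<in>{p..<q}. y i = s i) \<longrightarrow> y \<notin> N"
    by (elim exE conjE)
  have s: "y \<notin> N" if "t \<in> T" "N \<in> NN" "\<forall>i<p. y i = t i" "\<forall>i\<in>{p..<q}. y i = s i" for t N y
    using bspec[OF R, of "(t, N)"] that by simp
  show thesis
  proof (rule that)
    show "Suc q > p" "\<not> (s(q := False)) (Suc q - 1)"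
      using q by simp_all
    fix y N assume N: "N \<in> NN" and y: "\<forall>i\<in>{p..<Suc q}. y i = (s(q := False)) i"
    have "\<forall>i\<in>{p..<q}. y i = s i"
      using y by simp
    moreover obtain t where "t \<in> T" "\<forall>i<p. y i = t i"
      using T by blast
    ultimately show "y \<notin> N"
      using s N by blast
  qed
qed

text \<open>The description of meager sets by chopped reals. Block \<open>k\<close> avoids the
  nowhere dense sets with index at most \<open>k\<close>, so a point matching infinitely many blocks
  avoids all of them.\<close>

lemma meager_chopped:
  fixes B :: "cantor set"
  assumes "meager B"
  obtains p x where "strict_mono p" "p 0 = 0" "\<And>k. \<not> x (p (Suc k) - 1)"
    "\<And>y. \<exists>\<^sub>\<infinity>k. \<forall>i\<in>{p k..<p (Suc k)}. y i = x i \<Longrightarrow> y \<notin> B"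
proof -
  obtain NN where NN: "countable NN" "\<And>N. N \<in> NN \<Longrightarrow> nowhere_dense N" "B = \<Union>NN"
    using assms by (auto simp: meager_def)
  define M where "M = from_nat_into (insert {} NN)"
  have nd: "nowhere_dense (M n)" for n
  proof -
    have "M n \<in> insert {} NN"
      unfolding M_def by (rule from_nat_into) simp
    then show ?thesis
      using NN(2) by (auto simp: nowhere_dense_def)
  qed
  have "range M = insert {} NN"
    using NN(1) by (simp add: M_def)
  then have B: "B = (\<Union>n. M n)"
    using NN(3) by auto
  define P where "P k p q s \<longleftrightarrow> q > p \<and> \<not> s (q - 1) \<and>
      (\<forall>y n. n \<le> k \<longrightarrow> (\<forall>i\<in>{p..<q}. y i = s i) \<longrightarrow> y \<notin> M n)" for k p q and s :: cantor
  have ex: "\<exists>q s. P k p q s" for k p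
  proof -
    have fin: "finite (M ` {..k})"
      by simp
    have "nowhere_dense N" if "N \<in> M ` {..k}" for N
      using nd that by auto
    from fin this obtain q s where "q > p" "\<not> s (q - 1)"
      "\<And>y N. \<lbrakk>N \<in> M ` {..k}; \<forall>i\<in>{p..<q}. y i = s i\<rbrakk> \<Longrightarrow> y \<notin> N"
      by (rule nowhere_dense_block[where p = p]) blast+
    then show ?thesis
      unfolding P_def by (intro exI[of _ q] exI[of _ s]) simp
  qed
  define Q where "Q k p = (SOME q. \<exists>s. P k p q s)" for k p
  define S where "S k p = (SOME s. P k p (Q k p) s)" for k p
  have "P k p (Q k p) (S k p)" for k p
    unfolding S_def Q_def by (intro someI_ex[of "P k p (SOME q. \<exists>s. P k p q s)"] someI_ex[OF ex])
  then have Q: "Q k p > p" and S: "\<not> S k p (Q k p - 1)"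
    and QS: "\<And>y n. \<lbrakk>n \<le> k; \<forall>i\<in>{p..<Q k p}. y i = S k p i\<rbrakk> \<Longrightarrow> y \<notin> M n" for k p
    unfolding P_def by simp_all
  define p where "p = rec_nat 0 Q"
  have p: "p 0 = 0" "p (Suc k) = Q k (p k)" for k
    by (simp_all add: p_def)
  have mono: "strict_mono p"
    using Q by (simp add: strict_mono_Suc_iff p)
  have uniq: "k = l" if "i \<in> {p k..<p (Suc k)}" "i \<in> {p l..<p (Suc l)}" for i k l
    using that strict_mono_less_eq[OF mono, of "Suc k" l] strict_mono_less_eq[OF mono, of "Suc l" k]
    by (cases k l rule: linorder_cases) auto
  \<comment> \<open>The blocks are pairwise disjoint, so their prescribed values glue to a single
    point.\<close>
  define x where "x i = (\<exists>k. i \<in> {p k..<p (Suc k)} \<and> S k (p k) i)" for i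
  have x: "x i = S k (p k) i" if "i \<in> {p k..<p (Suc k)}" for i k
    unfolding x_def using uniq that by metis
  show thesis
  proof (rule that)
    show "strict_mono p" "p 0 = 0"
      by (fact mono p)+
    show "\<not> x (p (Suc k) - 1)" for k
    proof -
      have "p (Suc k) - 1 \<in> {p k..<p (Suc k)}"
        using Q[of "p k" k] by (auto simp: p)
      then show ?thesis
        using S[of k "p k"] by (simp add: x p)
    qed
    fix y assume inf: "\<exists>\<^sub>\<infinity>k. \<forall>i\<in>{p k..<p (Suc k)}. y i = x i"
    have "y \<notin> M n" for n
    proof -
      obtain k where k: "k \<ge> n" "\<forall>i\<in>{p k..<p (Suc k)}. y i = x i"
        using inf unfolding INFM_nat_le by blast
      then have "\<forall>i\<in>{p k..<Q k (p k)}. y i = S k (p k) i"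
        using x by (simp add: p)
      then show ?thesis
        using QS k(1) by blast
    qed
    then show "y \<notin> B"
      using B by blast
  qed
qed

text \<open>Baire's theorem for the Cantor space: the point of a chopped real matches itself on
  every block.\<close>

lemma UNIV_not_meager: "\<not> meager (UNIV :: cantor set)"
proof
  assume "meager (UNIV :: cantor set)"
  then obtain p x where "\<And>y :: cantor. \<exists>\<^sub>\<infinity>k::nat. \<forall>i\<in>{p k..<p (Suc k)}. y i = x i \<Longrightarrow> y \<notin> UNIV"
    by (rule meager_chopped) blast
  from this[of x] show False
    by (simp add: INFM_nat_le)
qed

section \<open>The connection with the meager ideal\<close>

text \<open>A point \<open>y\<close> offers at \<open>n\<close> the clopen set whose code is the length of the run of \<open>True\<close> that
  follows position \<open>n\<close>, provided \<open>y n\<close> holds and that set has small measure.\<close>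

definition run :: "cantor \<Rightarrow> nat \<Rightarrow> nat \<Rightarrow> bool" where
  "run y n j \<longleftrightarrow> (\<forall>i\<in>{n..n + j}. y i) \<and> \<not> y (Suc (n + j))"

text \<open>Runs are unique, so the union has at most one member; with no admissible run it is
  empty, hence still closed and small.\<close>

definition offer :: "cantor \<Rightarrow> nat \<Rightarrow> cantor set" where
  "offer y n = \<Union>{clopen_code j |j. run y n j \<and> measure cantor_measure (clopen_code j) \<le> (1/2) ^ n}"

lemma run_unique:
  assumes "run y n i" "run y n j"
  shows "i = j"
proof (rule ccontr)
  assume "i \<noteq> j"
  then consider "Suc (n + i) \<in> {n..n + j}" | "Suc (n + j) \<in> {n..n + i}"
    by force
  then show False
    using assms by cases (auto simp: run_def)
qed

lemma offer_eq:
  assumes "run y n j" "measure cantor_measure (clopen_code j) \<le> (1/2) ^ n"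
  shows "offer y n = clopen_code j"
proof -
  have "{clopen_code j |j. run y n j \<and> measure cantor_measure (clopen_code j) \<le> (1/2) ^ n} = {clopen_code j}"
    using assms run_unique by blast
  then show ?thesis
    by (simp add: offer_def)
qed

lemma offer_small: "closed (offer y n) \<and> measure cantor_measure (offer y n) \<le> (1/2) ^ n"
proof (cases "\<exists>j. run y n j \<and> measure cantor_measure (clopen_code j) \<le> (1/2) ^ n")
  case True
  then show ?thesis
    using offer_eq closed_clopen_code by metis
next
  case False
  then have "offer y n = {}"
    by (auto simp: offer_def)
  then show ?thesis
    by simp
qed

text \<open>Stronger than \<open>A \<subseteq> offer y n\<close>: even for empty \<open>A\<close> an
  actual run is required, which forces \<open>y n\<close>.\<close>

definition accepts :: "cantor \<Rightarrow> nat \<Rightarrow> cantor set \<Rightarrow> bool" where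
  "accepts y n A \<longleftrightarrow>
     (\<exists>j. run y n j \<and> measure cantor_measure (clopen_code j) \<le> (1/2) ^ n \<and> A \<subseteq> clopen_code j)"

lemma accepts_offer: "accepts y n A \<Longrightarrow> A \<subseteq> offer y n"
  using offer_eq by (auto simp: accepts_def)

definition escaping :: "(nat \<Rightarrow> cantor set) \<Rightarrow> cantor set" where
  "escaping C = {y. \<forall>\<^sub>\<infinity>n. \<not> accepts y n (C n)}"

text \<open>Any finite prefix can be prolonged by a run, starting at a late enough \<open>n\<close>,
  that encodes a small clopen cover of \<open>C n\<close>.\<close>

lemma meager_escaping:
  assumes "\<And>n. closed (C n)" "\<And>n. measure cantor_measure (C n) = 0"
  shows "meager (escaping C)"
proof -
  define N where "N m = {y. \<forall>n\<ge>m. \<not> accepts y n (C n)}" for m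
  have "nowhere_dense (N m)" for m
    unfolding nowhere_dense_def
  proof (rule ccontr)
    assume "interior (closure (N m)) \<noteq> {}"
    then obtain u l where u: "cylinder {..<l} u \<subseteq> interior (closure (N m))"
      using open_contains_cylinder[OF open_interior] by (metis all_not_in_conv)
    define n where "n = max l m"
    obtain j where j: "C n \<subseteq> clopen_code j" "measure cantor_measure (clopen_code j) < (1/2) ^ n"
      using small_clopen_cover[of "C n" "(1/2) ^ n"] assms by auto
    \<comment> \<open>After the prefix \<open>u\<close> comes \<open>False\<close> up to
      \<open>n\<close>, then the run for code \<open>j\<close>. The length \<open>n + j + 2\<close>
      below includes the \<open>False\<close> that ends the run.\<close>
    define v where "v i = (if i < l then u i else n \<le> i \<and> i \<le> n + j)" for i
    let ?V = "cylinder {..<n + j + 2} v"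
    have "accepts y n (C n)" if "y \<in> ?V" for y
    proof -
      have "run y n j"
        using that by (auto simp: run_def mem_cylinder_iff v_def n_def)
      then show ?thesis
        using j by (auto simp: accepts_def)
    qed
    then have "?V \<inter> N m = {}"
      by (fastforce simp: N_def n_def)
    then have "?V \<inter> closure (N m) = {}"
      by (simp add: open_Int_closure_eq_empty open_cylinder)
    moreover have "v \<in> ?V" "v \<in> cylinder {..<l} u"
      by (simp_all add: mem_cylinder_iff v_def)
    ultimately show False
      using u interior_subset[of "closure (N m)"] by blast
  qed
  moreover have "escaping C = \<Union>(range N)"
    by (auto simp: escaping_def N_def MOST_nat_le)
  ultimately show ?thesis
    unfolding meager_def by (intro exI[of _ "range N"]) auto
qed

text \<open>With infinitely many bad blocks, the point \<open>y\<close> that keeps \<open>x\<close>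
  only there lies outside \<open>B\<close>, so it accepts some \<open>C n\<close>. The run
  responsible stays inside one bad block and is therefore a run of \<open>x\<close>, a
  contradiction.\<close>

lemma escaping_subset_block_accepts:
  assumes mono: "strict_mono p" "p 0 = 0" and ends: "\<And>k. \<not> x (p (Suc k) - 1)"
    and avoid: "\<And>y. \<exists>\<^sub>\<infinity>k. \<forall>i\<in>{p k..<p (Suc k)}. y i = x i \<Longrightarrow> y \<notin> B"
    and sub: "escaping C \<subseteq> B"
  shows "\<forall>\<^sub>\<infinity>k. \<exists>n\<in>{p k..<p (Suc k)}. accepts x n (C n)"
proof (rule ccontr)
  define K where "K = {k. \<forall>n\<in>{p k..<p (Suc k)}. \<not> accepts x n (C n)}"
  define y where "y i \<longleftrightarrow> x i \<and> (\<exists>k\<in>K. i \<in> {p k..<p (Suc k)})" for i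
  assume "\<not> ?thesis"
  then have "\<exists>\<^sub>\<infinity>k. k \<in> K"
    by (simp add: K_def not_MOST)
  then have "\<exists>\<^sub>\<infinity>k. \<forall>i\<in>{p k..<p (Suc k)}. y i = x i"
    by (rule INFM_mono) (auto simp: y_def)
  then have "y \<notin> escaping C"
    using avoid sub by blast
  then obtain n where "accepts y n (C n)"
    by (auto simp: escaping_def MOST_nat_le)
  then obtain j where j: "run y n j" "measure cantor_measure (clopen_code j) \<le> (1/2) ^ n" "C n \<subseteq> clopen_code j"
    by (auto simp: accepts_def)
  then have "y n"
    by (simp add: run_def)
  then obtain k where k: "k \<in> K" "n \<in> {p k..<p (Suc k)}"
    by (auto simp: y_def)
  have x_true: "x i" if "i \<in> {n..n + j}" for i
    using j(1) that by (simp add: run_def y_def)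
  \<comment> \<open>A run reaching the last position of the block would make \<open>x\<close> true
    there, against \<open>ends\<close>.\<close>
  have "Suc (n + j) < p (Suc k)"
  proof (rule ccontr)
    assume "\<not> ?thesis"
    then have "p (Suc k) - 1 \<in> {n..n + j}"
      using k(2) by auto
    then show False
      using x_true ends by blast
  qed
  then have "Suc (n + j) \<in> {p k..<p (Suc k)}"
    using k(2) by simp
  moreover have "\<not> y (Suc (n + j))"
    using j(1) by (simp add: run_def)
  ultimately have "\<not> x (Suc (n + j))"
    using k(1) y_def by blast
  then have "run x n j"
    using x_true by (simp add: run_def)
  then have "accepts x n (C n)"
    using j by (auto simp: accepts_def)
  then show False
    using k by (auto simp: K_def)
qed

text \<open>The offers of block \<open>k\<close> have total measure at most a geometric tail bounded
  by \<open>2 * (1/2) ^ k\<close>, so intersecting over all \<open>k \<ge> m\<close> gives closed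
  null sets.\<close>

lemma block_offers_closed_null:
  assumes "strict_mono p"
  shows "{z. \<forall>\<^sub>\<infinity>k. \<exists>n\<in>{p k..<p (Suc k)}. z \<in> offer x n} \<in> closed_null_ideal"
proof -
  define F where "F k = (\<Union>n\<in>{p k..<p (Suc k)}. offer x n)" for k
  define D where "D m = (\<Inter>k\<in>{m..}. F k)" for m
  have closed_F: "closed (F k)" for k
    unfolding F_def using offer_small by (intro closed_UN) auto
  have measure_F: "measure cantor_measure (F k) \<le> 2 * (1/2) ^ k" for k
  proof -
    have "measure cantor_measure (F k) \<le> (\<Sum>n\<in>{p k..<p (Suc k)}. measure cantor_measure (offer x n))"
      unfolding F_def
      by (rule cantor.finite_measure_subadditive_finite) (use offer_small closed_in_sets_cantor in auto)
    also have "\<dots> \<le> (\<Sum>n\<in>{p k..<p (Suc k)}. (1/2) ^ n)"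
      by (rule sum_mono) (use offer_small in auto)
    also have "\<dots> \<le> 2 * (1/2) ^ p k"
    proof -
      \<comment> \<open>The subtracted term is what lets the induction on \<open>b\<close>
        close.\<close>
      have "(\<Sum>n\<in>{a..<b}. (1/2::real) ^ n) \<le> 2 * (1/2) ^ a - 2 * (1/2) ^ b" if "a \<le> b" for a b :: nat
        using that by (induction b rule: dec_induct) auto
      from this[of "p k" "p (Suc k)"] show ?thesis
        using strict_mono_leD[OF assms, of k "Suc k"] zero_le_power[of "1/2::real" "p (Suc k)"]
        by linarith
    qed
    also have "\<dots> \<le> 2 * (1/2) ^ k"
      using strict_mono_imp_increasing[OF assms, of k] by (simp add: power_decreasing)
    finally show ?thesis .
  qed
  have "closed (D m)" for m
    unfolding D_def using closed_F by auto
  moreover have "measure cantor_measure (D m) = 0" for m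
  proof -
    have "measure cantor_measure (D m) \<le> 2 * (1/2) ^ k" if "k \<ge> m" for k
    proof -
      have "measure cantor_measure (D m) \<le> measure cantor_measure (F k)"
        using that closed_F
        by (intro cantor.finite_measure_mono closed_in_sets_cantor) (auto simp: D_def)
      then show ?thesis
        using measure_F[of k] by simp
    qed
    then have "\<exists>N. \<forall>k\<ge>N. measure cantor_measure (D m) \<le> 2 * (1/2) ^ k"
      by blast
    moreover have "(\<lambda>k. 2 * (1/2::real) ^ k) \<longlonglongrightarrow> 2 * 0"
      by (intro tendsto_intros LIMSEQ_realpow_zero) auto
    ultimately have "measure cantor_measure (D m) \<le> 2 * 0"
      by (intro LIMSEQ_le_const)
    then show ?thesis
      using measure_nonneg[of cantor_measure "D m"] by simp
  qed
  moreover have "{z. \<forall>\<^sub>\<infinity>k. \<exists>n\<in>{p k..<p (Suc k)}. z \<in> offer x n} \<subseteq> (\<Union>m. D m)"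
    unfolding D_def F_def MOST_nat_le by blast
  ultimately show ?thesis
    unfolding closed_null_ideal_iff by blast
qed

text \<open>Membership in almost all \<open>C n\<close> ensures that whichever late index a block
  supplies, the point is covered there.\<close>

definition increasing_null_cover :: "(nat \<Rightarrow> cantor set) \<Rightarrow> cantor set \<Rightarrow> bool" where
  "increasing_null_cover C A \<longleftrightarrow>
     (\<forall>n. closed (C n) \<and> measure cantor_measure (C n) = 0) \<and> (\<forall>z\<in>A. \<forall>\<^sub>\<infinity>n. z \<in> C n)"

lemma closed_null_ideal_increasing_cover:
  assumes "A \<in> closed_null_ideal"
  shows "\<exists>C. increasing_null_cover C A"
proof -
  obtain D :: "nat \<Rightarrow> cantor set" where D: "\<And>n. closed (D n)" "\<And>n. measure cantor_measure (D n) = 0" "A \<subseteq> (\<Union>n. D n)"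
    using assms by (auto simp: closed_null_ideal_iff)
  have "closed (\<Union>i\<le>n. D i)" for n
    using D(1) by (intro closed_UN) auto
  moreover have "measure cantor_measure (\<Union>i\<le>n. D i) = 0" for n
  proof -
    have "measure cantor_measure (\<Union>i\<le>n. D i) \<le> (\<Sum>i\<le>n. measure cantor_measure (D i))"
      by (rule cantor.finite_measure_subadditive_finite) (use D(1) closed_in_sets_cantor in auto)
    then show ?thesis
      using D(2) measure_nonneg[of cantor_measure "\<Union>i\<le>n. D i"]
      by (simp add: measure_le_0_iff)
  qed
  moreover have "\<forall>\<^sub>\<infinity>n. z \<in> (\<Union>i\<le>n. D i)" if "z \<in> A" for z
  proof -
    obtain i where "z \<in> D i"
      using \<open>z \<in> A\<close> D(3) by blast
    then have "\<forall>n\<ge>i. z \<in> (\<Union>i\<le>n. D i)"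
      by blast
    then show ?thesis
      unfolding MOST_nat_le by blast
  qed
  ultimately show ?thesis
    unfolding increasing_null_cover_def by (intro exI[of _ "\<lambda>n. \<Union>i\<le>n. D i"]) simp
qed

text \<open>The set \<open>X\<close> is built from a chopped real for \<open>B\<close> alone, so it
  serves all covers \<open>C\<close> at once.\<close>

lemma meager_captures_closed_null:
  assumes "meager B"
  shows "\<exists>X\<in>closed_null_ideal. \<forall>C A. increasing_null_cover C A \<longrightarrow> escaping C \<subseteq> B \<longrightarrow> A \<subseteq> X"
proof -
  obtain p x where p: "strict_mono p" "p 0 = 0" and x: "\<And>k. \<not> x (p (Suc k) - 1)"
    and avoid: "\<And>y. \<exists>\<^sub>\<infinity>k. \<forall>i\<in>{p k..<p (Suc k)}. y i = x i \<Longrightarrow> y \<notin> B"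
    using assms by (rule meager_chopped) blast
  let ?X = "{z. \<forall>\<^sub>\<infinity>k. \<exists>n\<in>{p k..<p (Suc k)}. z \<in> offer x n}"
  have "A \<subseteq> ?X" if C: "increasing_null_cover C A" and sub: "escaping C \<subseteq> B" for C A
  proof
    fix z assume "z \<in> A"
    then obtain m where m: "\<And>n. n \<ge> m \<Longrightarrow> z \<in> C n"
      using C unfolding increasing_null_cover_def MOST_nat_le by blast
    have acc: "\<forall>\<^sub>\<infinity>k. \<exists>n\<in>{p k..<p (Suc k)}. accepts x n (C n)"
      using p x avoid sub by (rule escaping_subset_block_accepts)
    have "\<forall>\<^sub>\<infinity>k. k \<ge> m"
      unfolding MOST_nat_le by blast
    with acc have "\<forall>\<^sub>\<infinity>k. \<exists>n\<in>{p k..<p (Suc k)}. z \<in> offer x n"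
    proof eventually_elim
      case (elim k)
      then obtain n where n: "n \<in> {p k..<p (Suc k)}" "accepts x n (C n)"
        by blast
      \<comment> \<open>Indices in block \<open>k\<close> are at least
        \<open>p k \<ge> k\<close>.\<close>
      have "n \<ge> m"
        using n(1) elim(2) strict_mono_imp_increasing[OF p(1), of k] by simp
      then show ?case
        using m accepts_offer[OF n(2)] n(1) by blast
    qed
    then show "z \<in> ?X"
      by simp
  qed
  then show ?thesis
    using block_offers_closed_null[OF p(1)] by blast
qed

text \<open>The connection for inclusion: \<phi> takes the escaping set of a chosen cover, \<psi>
  the capturing set. No translation is involved yet.\<close>

proposition closed_null_Tukey_meager:
  obtains \<phi> \<psi> where "\<And>A. A \<in> closed_null_ideal \<Longrightarrow> \<phi> A \<in> meager_ideal"
    "\<And>B. B \<in> meager_ideal \<Longrightarrow> \<psi> B \<in> closed_null_ideal"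
    "\<And>A B. \<lbrakk>A \<in> closed_null_ideal; B \<in> meager_ideal; \<phi> A \<subseteq> B\<rbrakk> \<Longrightarrow> A \<subseteq> \<psi> B"
proof -
  obtain C where C: "\<forall>A\<in>closed_null_ideal. increasing_null_cover (C A) A"
    using bchoice[of closed_null_ideal "\<lambda>A C. increasing_null_cover C A"] closed_null_ideal_increasing_cover
    by blast
  have "\<forall>B\<in>meager_ideal. \<exists>X. X \<in> closed_null_ideal \<and>
      (\<forall>C A. increasing_null_cover C A \<longrightarrow> escaping C \<subseteq> B \<longrightarrow> A \<subseteq> X)"
    using meager_captures_closed_null unfolding meager_ideal_def by blast
  then obtain \<psi> where \<psi>: "\<forall>B\<in>meager_ideal. \<psi> B \<in> closed_null_ideal \<and>
      (\<forall>C A. increasing_null_cover C A \<longrightarrow> escaping C \<subseteq> B \<longrightarrow> A \<subseteq> \<psi> B)"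
    by (rule bchoice[THEN exE])
  show thesis
  proof (rule that)
    show "escaping (C A) \<in> meager_ideal" if "A \<in> closed_null_ideal" for A
      using bspec[OF C that] by (simp add: increasing_null_cover_def meager_ideal_def meager_escaping)
    show "\<psi> B \<in> closed_null_ideal" if "B \<in> meager_ideal" for B
      using bspec[OF \<psi> that] by simp
    show "A \<subseteq> \<psi> B" if "A \<in> closed_null_ideal" "B \<in> meager_ideal" "escaping (C A) \<subseteq> B" for A B
      using bspec[OF \<psi> that(2)] bspec[OF C that(1)] that(3) by blast
  qed
qed

section \<open>The connection with the bounding number\<close>

lemma cantor_add_cancel [simp]: "(z +\<^sub>2 x) +\<^sub>2 x = z"
  by (auto simp: cantor_add_def)

lemma translate_zero [simp]: "translate A (\<lambda>_. False) = A"
  by (simp add: translate_def cantor_add_def)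

text \<open>Translation is an involution; this links the form of the translated inclusion in
  \<open>ideal_add_star_t\<close> with that in \<open>ideal_cof_star_t\<close>.\<close>

lemma translate_subset_iff: "translate A x \<subseteq> B \<longleftrightarrow> A \<subseteq> translate B x"
proof
  assume sub: "translate A x \<subseteq> B"
  show "A \<subseteq> translate B x"
  proof
    fix a assume "a \<in> A"
    then have "a +\<^sub>2 x \<in> B"
      using sub by (auto simp: translate_def)
    then show "a \<in> translate B x"
      unfolding translate_def by (rule rev_image_eqI) simp
  qed
next
  assume "A \<subseteq> translate B x"
  then show "translate A x \<subseteq> B"
    by (fastforce simp: translate_def)
qed

lemma cylinder_subset_translate: "cylinder S x \<subseteq> translate (cylinder S (\<lambda>_. False)) x"
proof
  fix z assume "z \<in> cylinder S x"
  then have "z +\<^sub>2 x \<in> cylinder S (\<lambda>_. False)"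
    by (simp add: mem_cylinder_iff cantor_add_def)
  then show "z \<in> translate (cylinder S (\<lambda>_. False)) x"
    unfolding translate_def by (rule rev_image_eqI) simp
qed

text \<open>For each \<open>k\<close> the set lies in a cylinder on \<open>k\<close> coordinates, of
  measure \<open>(1/2) ^ k\<close>.\<close>

lemma cylinder_closed_null:
  assumes "infinite S"
  shows "cylinder S u \<in> closed_null_ideal"
proof -
  have "measure cantor_measure (cylinder S u) \<le> (1/2) ^ k" for k
  proof -
    obtain T where T: "T \<subseteq> S" "finite T" "card T = k"
      using infinite_arbitrarily_large[OF assms] by blast
    then have "cylinder S u \<subseteq> cylinder T u"
      by (auto simp: cylinder_def)
    then have "measure cantor_measure (cylinder S u) \<le> measure cantor_measure (cylinder T u)"
      by (intro cantor.finite_measure_mono closed_in_sets_cantor closed_cylinder)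
    then show ?thesis
      using T by (simp add: measure_cylinder)
  qed
  moreover have "(\<lambda>k. (1/2::real) ^ k) \<longlonglongrightarrow> 0"
    by (rule LIMSEQ_realpow_zero) auto
  ultimately have "measure cantor_measure (cylinder S u) \<le> 0"
    by (intro LIMSEQ_le_const) blast+
  then have "measure cantor_measure (cylinder S u) = 0"
    by (simp add: measure_le_0_iff)
  then show ?thesis
    unfolding closed_null_ideal_iff using closed_cylinder
    by (intro exI[of _ "\<lambda>_. cylinder S u"]) simp
qed

text \<open>The Baire category theorem inside the closed subspace \<open>cylinder P x\<close>, which the map \<open>r\<close>
  parametrises by the whole Cantor space.\<close>

lemma cylinder_portion_in_closed:
  assumes "cylinder P x \<subseteq> (\<Union>n::nat. X n)" "\<And>n. closed (X n)"
  obtains n m u where "cylinder ({..<m} \<union> P) u \<subseteq> X n"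
proof -
  define r where "r w i = (if i \<in> P then x i else w i)" for w :: cantor and i
  have "continuous_on UNIV (\<lambda>w. r w i)" for i
    by (cases "i \<in> P") (simp_all add: r_def)
  then have cont: "continuous_on UNIV r"
    by (rule continuous_on_coordinatewise_then_product)
  have closed_r: "closed (r -` X n)" for n
    using assms(2) cont by (rule closed_vimage)
  have "r w \<in> cylinder P x" for w
    by (simp add: r_def mem_cylinder_iff)
  then have "(\<Union>n. r -` X n) = UNIV"
    using assms(1) by blast
  then have "\<not> meager (\<Union>n. r -` X n)"
    using UNIV_not_meager by simp
  moreover have "meager (\<Union>n. r -` X n)" if "\<And>n. nowhere_dense (r -` X n)"
    unfolding meager_def using that by (intro exI[of _ "range (\<lambda>n. r -` X n)"]) auto
  ultimately obtain n where "\<not> nowhere_dense (r -` X n)"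
    by blast
  then have "interior (r -` X n) \<noteq> {}"
    using closed_r by (simp add: nowhere_dense_def)
  then obtain w where "w \<in> interior (r -` X n)"
    by blast
  then obtain m where m: "cylinder {..<m} w \<subseteq> interior (r -` X n)"
    using open_contains_cylinder[OF open_interior] by metis
  have "cylinder ({..<m} \<union> P) (r w) \<subseteq> X n"
  proof
    fix z assume z: "z \<in> cylinder ({..<m} \<union> P) (r w)"
    \<comment> \<open>A preimage of \<open>z\<close> under \<open>r\<close> inside the cylinder
      around \<open>w\<close>; on \<open>P\<close> the points \<open>z\<close> and
      \<open>r w\<close> already agree.\<close>
    define w' where "w' i = (if i < m then w i else z i)" for i
    have "w' \<in> cylinder {..<m} w"
      by (simp add: w'_def mem_cylinder_iff)
    then have "r w' \<in> X n"
      using m interior_subset by blast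
    moreover have "r w' i = z i" for i
      using z by (simp add: r_def w'_def mem_cylinder_iff)
    then have "r w' = z"
      by (rule ext)
    ultimately show "z \<in> X n"
      by simp
  qed
  then show thesis
    by (rule that)
qed

text \<open>If \<open>p k \<ge> M\<close>, at most \<open>m + k \<le> 2 * k\<close> coordinates
  below \<open>M\<close> are constrained, so \<open>approx X M\<close> contains a cylinder of
  measure at least \<open>(1/2) ^ (2 * k)\<close>.\<close>

lemma portion_density_bound:
  assumes sub: "cylinder ({..<m} \<union> range p) u \<subseteq> X" and mono: "strict_mono p"
    and X: "closed X" and k: "m \<le> k"
    and small: "measure cantor_measure (approx X M) < (1/2) ^ (2 * k)"
  shows "p k < M"
proof (rule ccontr)
  assume "\<not> p k < M"
  define S where "S = {..<m} \<union> p ` {..<k}"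
  have "cylinder S u \<subseteq> approx X M"
  proof
    fix z assume z: "z \<in> cylinder S u"
    \<comment> \<open>Continuing by \<open>u\<close> from \<open>M\<close> on puts the point into
      \<open>X\<close> without changing its first \<open>M\<close> coordinates.\<close>
    define a where "a i = (if i < M then z i else u i)" for i
    have "a i = u i" if i: "i \<in> {..<m} \<union> range p" for i
    proof (cases "i < M \<and> i \<notin> {..<m}")
      case True
      then obtain l where l: "i = p l"
        using i by blast
      then have "l < k"
        using True \<open>\<not> p k < M\<close> strict_mono_less[OF mono, of l k] by simp
      then show ?thesis
        using z l by (simp add: mem_cylinder_iff S_def a_def)
    next
      case False
      then show ?thesis
        using z by (auto simp: mem_cylinder_iff S_def a_def)
    qed
    then have "a \<in> X"
      using sub by (auto simp: mem_cylinder_iff)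
    moreover have "z \<in> cylinder {..<M} a"
      by (simp add: mem_cylinder_iff a_def)
    ultimately show "z \<in> approx X M"
      unfolding approx_def by blast
  qed
  moreover have "approx X M \<in> sets cantor_measure"
    by (metis approx_eq_clopen_code closed_clopen_code closed_in_sets_cantor)
  ultimately have "measure cantor_measure (cylinder S u) \<le> measure cantor_measure (approx X M)"
    by (rule cantor.finite_measure_mono)
  moreover have "card S \<le> 2 * k"
  proof -
    have "card S \<le> card {..<m} + card (p ` {..<k})"
      unfolding S_def by (rule card_Un_le)
    also have "\<dots> \<le> 2 * k"
      using k card_image_le[of "{..<k}" p] by simp
    finally show ?thesis .
  qed
  then have "(1/2::real) ^ (2 * k) \<le> (1/2) ^ card S"
    by (intro power_decreasing) auto
  moreover have "finite S"
    by (simp add: S_def)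
  ultimately show False
    using small by (simp add: measure_cylinder)
qed

definition spread :: "(nat \<Rightarrow> nat) \<Rightarrow> nat \<Rightarrow> nat" where
  "spread f k = k + (\<Sum>i\<le>k. f i)"

lemma strict_mono_spread: "strict_mono (spread f)"
  by (simp add: strict_mono_Suc_iff spread_def)

lemma le_spread: "f k \<le> spread f k"
  unfolding spread_def using member_le_sum[of k "{..k}" f] by simp

lemma closed_null_bounds_spread:
  assumes "X \<in> closed_null_ideal"
  shows "\<exists>g. \<forall>f x. translate (cylinder (range (spread f)) (\<lambda>_. False)) x \<subseteq> X \<longrightarrow> f \<le>\<^sup>* g"
proof -
  obtain C :: "nat \<Rightarrow> cantor set" where C: "\<And>n. closed (C n)" "\<And>n. measure cantor_measure (C n) = 0" "X \<subseteq> (\<Union>n. C n)"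
    using assms by (auto simp: closed_null_ideal_iff)
  have "\<exists>M. measure cantor_measure (approx (C n) M) < (1/2) ^ (2 * k)" for n k
    using measure_approx_lt[OF C(1,2), of "(1/2) ^ (2 * k)" n] by auto
  then obtain G where G: "\<And>n k. measure cantor_measure (approx (C n) (G n k)) < (1/2) ^ (2 * k)"
    by metis
  \<comment> \<open>For each fixed \<open>n\<close> the sum includes \<open>G n k\<close> once
    \<open>k \<ge> n\<close>, so one \<open>g\<close> eventually bounds every rate function.\<close>
  define g where "g k = (\<Sum>n\<le>k. G n k)" for k
  have "f \<le>\<^sup>* g" if "translate (cylinder (range (spread f)) (\<lambda>_. False)) x \<subseteq> X" for f x
  proof -
    have "cylinder (range (spread f)) x \<subseteq> (\<Union>n. C n)"
      using cylinder_subset_translate that C(3) by blast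
    then obtain n m u where portion: "cylinder ({..<m} \<union> range (spread f)) u \<subseteq> C n"
      using C(1) by (rule cylinder_portion_in_closed)
    have "f k \<le> g k" if "k \<ge> max m n" for k
    proof -
      have "spread f k < G n k"
        by (rule portion_density_bound[OF portion strict_mono_spread C(1) _ G]) (use that in simp)
      moreover have "G n k \<le> g k"
        unfolding g_def using that by (intro member_le_sum) auto
      ultimately show ?thesis
        using le_spread[of f k] by linarith
    qed
    then show ?thesis
      unfolding le_star_def eventually_sequentially by blast
  qed
  then show ?thesis
    by blast
qed

text \<open>The bound \<beta> depends on \<open>X\<close> only, so each \<open>f\<close> may use its
  own translation.\<close>

proposition bounding_Tukey_closed_null:
  obtains \<alpha> \<beta> where "\<And>f. \<alpha> f \<in> closed_null_ideal"
    "\<And>f X x. \<lbrakk>X \<in> closed_null_ideal; translate (\<alpha> f) x \<subseteq> X\<rbrakk> \<Longrightarrow> f \<le>\<^sup>* \<beta> X"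
proof -
  have "cylinder (range (spread f)) (\<lambda>_. False) \<in> closed_null_ideal" for f
    using strict_mono_imp_inj_on[OF strict_mono_spread] by (intro cylinder_closed_null range_inj_infinite)
  moreover obtain \<beta> where "\<forall>X\<in>closed_null_ideal. \<forall>f x.
      translate (cylinder (range (spread f)) (\<lambda>_. False)) x \<subseteq> X \<longrightarrow> f \<le>\<^sup>* \<beta> X"
    using bchoice[of closed_null_ideal
        "\<lambda>X g. \<forall>f x. translate (cylinder (range (spread f)) (\<lambda>_. False)) x \<subseteq> X \<longrightarrow> f \<le>\<^sup>* g"]
      closed_null_bounds_spread by blast
  ultimately show thesis
    by (intro that[of "\<lambda>f. cylinder (range (spread f)) (\<lambda>_. False)" \<beta>]) blast+
qed

text \<open>The successor of a supposed bound escapes it. Hence the minima for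
  \<open>bounding_number\<close> and \<open>ideal_add_star_t\<close> range over nonempty
  collections.\<close>

lemma not_all_bounded: "\<not> (\<exists>g. \<forall>f\<in>UNIV. f \<le>\<^sup>* g)"
proof
  assume "\<exists>g. \<forall>f\<in>UNIV. f \<le>\<^sup>* g"
  then obtain g where "(\<lambda>n. Suc (g n)) \<le>\<^sup>* g"
    by blast
  then show False
    by (auto simp: le_star_def)
qed

section \<open>The four inequalities from the two connections\<close>

theorem theorem4p13:
  shows "(ideal_add meager_ideal \<le>o ideal_add_star_t closed_null_ideal \<and>
          ideal_add_star_t closed_null_ideal \<le>o bounding_number) \<and>
         (dominating_number \<le>o ideal_cof_star_t closed_null_ideal \<and>
          ideal_cof_star_t closed_null_ideal \<le>o ideal_cof meager_ideal)"
proof -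
  let ?E = closed_null_ideal and ?M = meager_ideal
  obtain \<phi> \<psi> where \<phi>: "\<And>A. A \<in> ?E \<Longrightarrow> \<phi> A \<in> ?M" and \<psi>: "\<And>B. B \<in> ?M \<Longrightarrow> \<psi> B \<in> ?E"
    and \<phi>\<psi>: "\<And>A B. \<lbrakk>A \<in> ?E; B \<in> ?M; \<phi> A \<subseteq> B\<rbrakk> \<Longrightarrow> A \<subseteq> \<psi> B"
    by (rule closed_null_Tukey_meager) blast
  obtain \<alpha> \<beta> where \<alpha>: "\<And>f. \<alpha> f \<in> ?E"
    and \<alpha>\<beta>: "\<And>f X x. \<lbrakk>X \<in> ?E; translate (\<alpha> f) x \<subseteq> X\<rbrakk> \<Longrightarrow> f \<le>\<^sup>* \<beta> X"
    by (rule bounding_Tukey_closed_null) blast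
  have unbounded: "\<alpha> ` F \<subseteq> ?E \<and> \<not> (\<exists>X\<in>?E. \<forall>A\<in>\<alpha> ` F. \<exists>x. translate A x \<subseteq> X)"
    if "\<not> (\<exists>g. \<forall>f\<in>F. f \<le>\<^sup>* g)" for F
  proof (intro conjI notI)
    show "\<alpha> ` F \<subseteq> ?E"
      using \<alpha> by blast
    assume "\<exists>X\<in>?E. \<forall>A\<in>\<alpha> ` F. \<exists>x. translate A x \<subseteq> X"
    then obtain X where X: "X \<in> ?E" "\<And>f. f \<in> F \<Longrightarrow> \<exists>x. translate (\<alpha> f) x \<subseteq> X"
      by blast
    then have "\<forall>f\<in>F. f \<le>\<^sup>* \<beta> X"
      using \<alpha>\<beta> by blast
    with that show False
      by blast
  qed
  have "ideal_add ?M \<le>o ideal_add_star_t ?E"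
  proof -
    obtain F where F: "F \<subseteq> ?E" "\<not> (\<exists>X\<in>?E. \<forall>A\<in>F. \<exists>x. translate A x \<subseteq> X)"
      and card: "ideal_add_star_t ?E = |F|"
      unfolding ideal_add_star_t_def using unbounded[OF not_all_bounded] by (rule min_card_attained) blast
    \<comment> \<open>Otherwise \<psi> of this union would contain every member of \<open>F\<close>,
      with the zero translation.\<close>
    have "\<Union>(\<phi> ` F) \<notin> ?M"
    proof
      assume B: "\<Union>(\<phi> ` F) \<in> ?M"
      have "translate A (\<lambda>_. False) \<subseteq> \<psi> (\<Union>(\<phi> ` F))" if "A \<in> F" for A
        unfolding translate_zero using F(1) that by (intro \<phi>\<psi> B) auto
      then show False
        using F(2) \<psi>[OF B] by blast
    qed
    moreover have "\<phi> ` F \<subseteq> ?M"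
      using F(1) \<phi> by blast
    ultimately have "ideal_add ?M \<le>o |\<phi> ` F|"
      unfolding ideal_add_def by (intro min_card_le conjI)
    then show ?thesis
      unfolding card using card_of_image ordLeq_transitive by blast
  qed
  moreover have "ideal_add_star_t ?E \<le>o bounding_number"
  proof -
    obtain F where F: "\<not> (\<exists>g. \<forall>f\<in>F. f \<le>\<^sup>* g)" and card: "bounding_number = |F|"
      unfolding bounding_number_def using not_all_bounded by (rule min_card_attained)
    have "ideal_add_star_t ?E \<le>o |\<alpha> ` F|"
      unfolding ideal_add_star_t_def using unbounded[OF F] by (rule min_card_le)
    then show ?thesis
      unfolding card using card_of_image ordLeq_transitive by blast
  qed
  moreover have "dominating_number \<le>o ideal_cof_star_t ?E"
  proof -
    let ?P = "\<lambda>F. F \<subseteq> ?E \<and> (\<forall>Y\<in>?E. \<exists>Y'\<in>F. \<exists>x. Y \<subseteq> translate Y' x)"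
    have "?P ?E"
      by (metis order_refl translate_zero)
    then obtain F where "?P F" and card: "ideal_cof_star_t ?E = |F|"
      unfolding ideal_cof_star_t_def by (rule min_card_attained[of ?P])
    then have F: "F \<subseteq> ?E" "\<forall>Y\<in>?E. \<exists>Y'\<in>F. \<exists>x. Y \<subseteq> translate Y' x"
      by blast+
    \<comment> \<open>A translate of some \<open>X\<close> in \<open>F\<close> covers \<alpha> of
      \<open>f\<close>; moving the translation to the other side makes \<beta> of \<open>X\<close> a
      bound for \<open>f\<close>.\<close>
    have "\<exists>h\<in>\<beta> ` F. f \<le>\<^sup>* h" for f
    proof -
      obtain X x where X: "X \<in> F" "\<alpha> f \<subseteq> translate X x"
        using bspec[OF F(2) \<alpha>[of f]] by (elim bexE exE)
      then have "f \<le>\<^sup>* \<beta> X"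
        using F(1) by (intro \<alpha>\<beta>[of X f x]) (auto simp: translate_subset_iff)
      with X(1) show ?thesis
        by blast
    qed
    then have "dominating_number \<le>o |\<beta> ` F|"
      unfolding dominating_number_def by (intro min_card_le allI)
    then show ?thesis
      unfolding card using card_of_image ordLeq_transitive by blast
  qed
  moreover have "ideal_cof_star_t ?E \<le>o ideal_cof ?M"
  proof -
    let ?P = "\<lambda>F. F \<subseteq> ?M \<and> (\<forall>Y\<in>?M. \<exists>Y'\<in>F. Y \<subseteq> Y')"
    have "?P ?M"
      by blast
    then obtain F where "?P F" and card: "ideal_cof ?M = |F|"
      unfolding ideal_cof_def by (rule min_card_attained[of ?P])
    then have F: "F \<subseteq> ?M" "\<forall>Y\<in>?M. \<exists>Y'\<in>F. Y \<subseteq> Y'"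
      by blast+
    have "\<psi> ` F \<subseteq> ?E"
      using F(1) \<psi> by blast
    moreover have "\<exists>Y'\<in>\<psi> ` F. \<exists>x. Y \<subseteq> translate Y' x" if "Y \<in> ?E" for Y
    proof -
      obtain B where "B \<in> F" "\<phi> Y \<subseteq> B"
        using F(2) \<phi>[OF \<open>Y \<in> ?E\<close>] by blast
      then have "Y \<subseteq> translate (\<psi> B) (\<lambda>_. False)"
        unfolding translate_zero using F(1) that by (intro \<phi>\<psi>) auto
      then show ?thesis
        using \<open>B \<in> F\<close> by blast
    qed
    ultimately have "ideal_cof_star_t ?E \<le>o |\<psi> ` F|"
      unfolding ideal_cof_star_t_def by (intro min_card_le conjI ballI)
    then show ?thesis
      unfolding card using card_of_image ordLeq_transitive by blast
  qed
  ultimately show ?thesis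
    by blast
qed

end
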